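(* Let $(\mathfrak{H},[\cdot,\cdot])$ be a Krein space with fundamental symmetry $J$ and let $\mathcal{F}=\{f_n\}_{n\in\mathbb{N}}$ be a $J$-orthogonal sequence of nonzero vectors in $\mathfrak{H}$. Then $\mathcal{F}$ is a $J$-frame if and only if $\mathcal{F}$ is $J$-bounded, i.e. there are constants $A,B$ with $$0<A\le|[f_n,f_n]|\le B<\infty\qquad\text{for all }f_n\in\mathcal{F},$$ and the subspaces $\mathcal{M}_\pm$ are maximal definite in the Krein space $(\mathfrak{H},[\cdot,\cdot])$.
   Context: A Krein space $(\mathfrak{H},[\cdot,\cdot])$ is a complex (infinite-dimensional) linear space with an indefinite inner product admitting a fundamental decomposition $\mathfrak{H}=\mathfrak{H}_+[\dot{+}]\mathfrak{H}_-$, a $[\cdot,\cdot]$-orthogonal direct sum of Hilbert spaces $(\mathfrak{H}_+,[\cdot,\cdot])$ and $(\mathfrak{H}_-,-[\cdot,\cdot])$. A fundamental decomposition is fixed; its fundamental symmetry is $J(f_++f_-)=f_+-f_-$ ($f_\pm\in\mathfrak{H}_\pm$), and $(\cdot,\cdot)=[J\cdot,\cdot]$, $\|\cdot\|=\sqrt{(\cdot,\cdot)}$ is the associated Hilbert space inner product and norm. Subspaces are closed and topological notions refer to $\|\cdot\|$. A subspace $\mathcal{L}$ is positive (negative) if $[f,f]>0$ ($[f,f]<0$) for all nonzero $f\in\mathcal{L}$, and maximal positive (negative) if it is not a proper subspace of another positive (negative) subspace. "$\mathcal{M}_\pm$ are maximal definite" means $\mathcal{M}_+$ is maximal positive and $\mathcal{M}_-$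 is maximal negative. A sequence is $J$-orthogonal if $[f_n,f_m]=0$ for $n\ne m$. For $\mathcal{F}=\{f_n\}$ put $\mathbb{N}_+=\{n:[f_n,f_n]\ge0\}$, $\mathbb{N}_-=\{n:[f_n,f_n]<0\}$, $\mathcal{F}_\pm=\{f_n\}_{n\in\mathbb{N}_\pm}$, $\mathcal{M}_\pm=\overline{\mathrm{span}\,\mathcal{F}_\pm}$. $\mathcal{F}$ is a $J$-frame if $\mathcal{M}_\pm$ are maximal definite and there are constants $0<A\le B$ with $A|[f,f]|\le\sum_{n\in\mathbb{N}_+}|[f,f_n]|^2\le B|[f,f]|$ for all $f\in\mathrm{span}\,\mathcal{F}_+$, and $A|[f,f]|\le\sum_{n\in\mathbb{N}_-}|[f,f_n]|^2\le B|[f,f]|$ for all $f\in\mathrm{span}\,\mathcal{F}_-$. *)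

theory Defs
  imports "HOL-Analysis.Analysis"
begin

(* For a positive definite g, the value g x x is a nonnegative real, so cmod (g x x) = g x x.
   Using cmod makes ip_dist nonnegative and symmetric on the whole type, as the locale
   Metric_space requires even when its carrier is a proper subset. *)
definition ip_norm :: "('a \<Rightarrow> 'a \<Rightarrow> complex) \<Rightarrow> 'a \<Rightarrow> real" where
  "ip_norm g x = sqrt (cmod (g x x))"

definition ip_dist :: "('a::ab_group_add \<Rightarrow> 'a \<Rightarrow> complex) \<Rightarrow> 'a \<Rightarrow> 'a \<Rightarrow> real" where
  "ip_dist g x y = ip_norm g (x - y)"

text \<open>
  The inner product \<open>ip\<close> is linear in its first argument. It is Hermitian, so \<open>ip x x\<close> is
  real and its sign is expressed through \<open>Re (ip x x)\<close>. Neither definiteness nor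
  non-degeneracy is assumed here.
\<close>

locale indefinite_inner_product_space = vector_space scale
  for scale :: "complex \<Rightarrow> 'a::ab_group_add \<Rightarrow> 'a" +
  fixes ip :: "'a \<Rightarrow> 'a \<Rightarrow> complex"
  assumes ip_add_left: "ip (x + y) z = ip x z + ip y z"
    and ip_scale_left: "ip (scale c x) y = c * ip x y"
    and ip_hermitian: "ip y x = cnj (ip x y)"
begin

definition hilbert_space_on :: "'a set \<Rightarrow> ('a \<Rightarrow> 'a \<Rightarrow> complex) \<Rightarrow> bool" where
  "hilbert_space_on L g \<longleftrightarrow>
     subspace L \<and>
     (\<forall>x\<in>L. \<forall>y\<in>L. \<forall>z\<in>L. g (x + y) z = g x z + g y z) \<and>
     (\<forall>c. \<forall>x\<in>L. \<forall>y\<in>L. g (scale c x) y = c * g x y) \<and>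
     (\<forall>x\<in>L. \<forall>y\<in>L. g y x = cnj (g x y)) \<and>
     (\<forall>x\<in>L. x \<noteq> 0 \<longrightarrow> 0 < Re (g x x)) \<and>
     Metric_space.mcomplete L (ip_dist g)"

definition fundamental_decomposition :: "'a set \<Rightarrow> 'a set \<Rightarrow> bool" where
  "fundamental_decomposition Hp Hm \<longleftrightarrow>
     hilbert_space_on Hp ip \<and>
     hilbert_space_on Hm (\<lambda>x y. - ip x y) \<and>
     (\<forall>x\<in>Hp. \<forall>y\<in>Hm. ip x y = 0) \<and>
     Hp \<inter> Hm = {0} \<and>
     (\<forall>h. \<exists>x\<in>Hp. \<exists>y\<in>Hm. h = x + y)"

(* J determines its decomposition: Hp and Hm are the eigenspaces of J for 1 and -1. Hence
   fixing J is the same as fixing a fundamental decomposition. *)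
definition fundamental_symmetry :: "('a \<Rightarrow> 'a) \<Rightarrow> bool" where
  "fundamental_symmetry J \<longleftrightarrow>
     (\<exists>Hp Hm. fundamental_decomposition Hp Hm \<and> (\<forall>x\<in>Hp. \<forall>y\<in>Hm. J (x + y) = x - y))"

definition J_orthogonal :: "(nat \<Rightarrow> 'a) \<Rightarrow> bool" where
  "J_orthogonal f \<longleftrightarrow> (\<forall>n m. n \<noteq> m \<longrightarrow> ip (f n) (f m) = 0)"

definition J_bounded :: "(nat \<Rightarrow> 'a) \<Rightarrow> bool" where
  "J_bounded f \<longleftrightarrow>
     (\<exists>A B. 0 < A \<and> (\<forall>n. A \<le> cmod (ip (f n) (f n)) \<and> cmod (ip (f n) (f n)) \<le> B))"

definition N_plus :: "(nat \<Rightarrow> 'a) \<Rightarrow> nat set" where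
  "N_plus f = {n. Re (ip (f n) (f n)) \<ge> 0}"

definition N_minus :: "(nat \<Rightarrow> 'a) \<Rightarrow> nat set" where
  "N_minus f = {n. Re (ip (f n) (f n)) < 0}"

end

locale krein_space = indefinite_inner_product_space scale ip
  for scale :: "complex \<Rightarrow> 'a::ab_group_add \<Rightarrow> 'a" and ip :: "'a \<Rightarrow> 'a \<Rightarrow> complex" +
  fixes J :: "'a \<Rightarrow> 'a"
  assumes infinite_dimensional: "\<nexists>S. finite S \<and> span S = UNIV"
    and fundamental_symmetry: "fundamental_symmetry J"
begin

definition hilbert_ip :: "'a \<Rightarrow> 'a \<Rightarrow> complex" where
  "hilbert_ip x y = ip (J x) y"

definition krein_topology :: "'a topology" where
  "krein_topology = Metric_space.mtopology UNIV (ip_dist hilbert_ip)"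

definition closed_subspace :: "'a set \<Rightarrow> bool" where
  "closed_subspace L \<longleftrightarrow> subspace L \<and> closedin krein_topology L"

definition positive_subspace :: "'a set \<Rightarrow> bool" where
  "positive_subspace L \<longleftrightarrow> closed_subspace L \<and> (\<forall>x\<in>L. x \<noteq> 0 \<longrightarrow> Re (ip x x) > 0)"

definition negative_subspace :: "'a set \<Rightarrow> bool" where
  "negative_subspace L \<longleftrightarrow> closed_subspace L \<and> (\<forall>x\<in>L. x \<noteq> 0 \<longrightarrow> Re (ip x x) < 0)"

definition maximal_positive :: "'a set \<Rightarrow> bool" where
  "maximal_positive L \<longleftrightarrow>
     positive_subspace L \<and> (\<nexists>L'. positive_subspace L' \<and> L \<subset> L')"

definition maximal_negative :: "'a set \<Rightarrow> bool" where
  "maximal_negative L \<longleftrightarrow>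
     negative_subspace L \<and> (\<nexists>L'. negative_subspace L' \<and> L \<subset> L')"

definition M_plus :: "(nat \<Rightarrow> 'a) \<Rightarrow> 'a set" where
  "M_plus f = krein_topology closure_of (span (f ` N_plus f))"

definition M_minus :: "(nat \<Rightarrow> 'a) \<Rightarrow> 'a set" where
  "M_minus f = krein_topology closure_of (span (f ` N_minus f))"

definition maximal_definite :: "(nat \<Rightarrow> 'a) \<Rightarrow> bool" where
  "maximal_definite f \<longleftrightarrow> maximal_positive (M_plus f) \<and> maximal_negative (M_minus f)"

(* infsum is 0 on families that are not summable, so summability, which the finite upper
   bound entails, is required separately. *)
definition frame_bounds_on :: "(nat \<Rightarrow> 'a) \<Rightarrow> nat set \<Rightarrow> real \<Rightarrow> real \<Rightarrow> bool" where
  "frame_bounds_on f N A B \<longleftrightarrow>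
     (\<forall>x\<in>span (f ` N).
        (\<lambda>n. (cmod (ip x (f n)))\<^sup>2) summable_on N \<and>
        A * cmod (ip x x) \<le> (\<Sum>\<^sub>\<infinity>n\<in>N. (cmod (ip x (f n)))\<^sup>2) \<and>
        (\<Sum>\<^sub>\<infinity>n\<in>N. (cmod (ip x (f n)))\<^sup>2) \<le> B * cmod (ip x x))"

definition J_frame :: "(nat \<Rightarrow> 'a) \<Rightarrow> bool" where
  "J_frame f \<longleftrightarrow>
     maximal_definite f \<and>
     (\<exists>A B. 0 < A \<and> A \<le> B \<and>
        frame_bounds_on f (N_plus f) A B \<and> frame_bounds_on f (N_minus f) A B)"

end

end

theory Submission
  imports Defs
begin

text \<open>
  For a finite combination \<open>x = \<Sum>n\<in>T. c\<^sub>n f\<^sub>n\<close> of pairwise orthogonal vectors of the same sign,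
  \<open>\<bar>[x, x]\<bar> = \<Sum>n\<in>T. \<bar>c\<^sub>n\<bar>\<^sup>2 \<bar>[f\<^sub>n, f\<^sub>n]\<bar>\<close>, whereas the frame sum is
  \<open>\<Sum>n\<in>T. \<bar>c\<^sub>n\<bar>\<^sup>2 \<bar>[f\<^sub>n, f\<^sub>n]\<bar>\<^sup>2\<close>. Comparing termwise, bounds on \<open>\<bar>[f\<^sub>n, f\<^sub>n]\<bar>\<close> are frame bounds.
  Conversely, the frame inequalities at \<open>x = f\<^sub>n\<close> give back the bounds, because
  \<open>[f\<^sub>n, f\<^sub>n] \<noteq> 0\<close> by definiteness of the subspaces \<open>M\<^sub>\<plusminus>\<close>.
\<close>

context indefinite_inner_product_space
begin

section \<open>Sesquilinear algebra of a Hermitian form, and the metric it induces when positive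
  definite\<close>

lemma ip_zero_left: "ip 0 y = 0"
  using ip_add_left[of 0 0 y] by simp

lemma ip_add_right: "ip x (y + z) = ip x y + ip x z"
  by (metis complex_cnj_add ip_add_left ip_hermitian)

lemma ip_scale_right: "ip x (scale c y) = cnj c * ip x y"
  by (metis complex_cnj_mult ip_hermitian ip_scale_left)

lemma ip_minus_left: "ip (- x) y = - ip x y"
  using ip_add_left[of x "- x" y] by (simp add: ip_zero_left eq_neg_iff_add_eq_0 add.commute)

lemma ip_minus_right: "ip x (- y) = - ip x y"
  by (metis complex_cnj_minus ip_hermitian ip_minus_left)

lemma ip_diff_left: "ip (x - y) z = ip x z - ip y z"
  using ip_add_left[of x "- y" z] by (simp add: ip_minus_left)

lemma ip_diff_right: "ip x (y - z) = ip x y - ip x z"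
  using ip_add_right[of x y "- z"] by (simp add: ip_minus_right)

lemma ip_sum_left: "ip (sum g T) y = (\<Sum>n\<in>T. ip (g n) y)"
  by (induction T rule: infinite_finite_induct) (simp_all add: ip_zero_left ip_add_left)

lemma ip_self: "ip x x = complex_of_real (Re (ip x x))"
  using ip_hermitian[of x x] by (simp add: complex_eq_iff)

lemma Re_ip_commute: "Re (ip y x) = Re (ip x y)"
  using ip_hermitian[of y x] by simp

lemma cmod_ip_self: "cmod (ip x x) = \<bar>Re (ip x x)\<bar>"
  by (subst ip_self) (simp only: norm_of_real)

text \<open>Cauchy-Schwarz for the real part, which is all that the cross terms of a triangle
  inequality involve. Positivity is a hypothesis so that the result can be applied to
  \<open>hilbert_ip\<close>, since \<open>ip\<close> itself is indefinite in general.\<close>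

lemma Re_ip_power2_le:
  assumes pos: "\<And>x. x \<noteq> 0 \<Longrightarrow> 0 < Re (ip x x)"
  shows "(Re (ip x y))\<^sup>2 \<le> Re (ip x x) * Re (ip y y)"
proof (cases "y = 0")
  case True
  then show ?thesis
    by (simp add: ip_zero_left Re_ip_commute[of x 0])
next
  case False
  define a where "a = Re (ip x x)"
  define b where "b = Re (ip y y)"
  define r where "r = Re (ip x y)"
  \<comment> \<open>\<open>z\<close> is \<open>b\<close> times the component of \<open>x\<close>
    orthogonal to \<open>y\<close> for the real form \<open>Re (ip _ _)\<close>; the factor
    \<open>b\<close> avoids dividing by \<open>Re (ip y y)\<close>.\<close>
  define z where "z = scale (of_real b) x - scale (of_real r) y"
  have "0 \<le> Re (ip z z)"
    using pos[of z] by (cases "z = 0") (auto simp: ip_zero_left)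
  also have "Re (ip z z) = b * (a * b - r\<^sup>2)"
    unfolding z_def
    by (simp add: ip_diff_left ip_diff_right ip_scale_left ip_scale_right
        Re_ip_commute[of y x] a_def[symmetric] b_def[symmetric] r_def[symmetric]
        algebra_simps power2_eq_square)
  finally have "0 \<le> a * b - r\<^sup>2"
    using pos[OF False] by (simp add: b_def zero_le_mult_iff)
  then show ?thesis
    by (simp add: a_def b_def r_def)
qed

lemma ip_norm_triangle:
  assumes pos: "\<And>x. x \<noteq> 0 \<Longrightarrow> 0 < Re (ip x x)"
  shows "ip_norm ip (x + y) \<le> ip_norm ip x + ip_norm ip y"
proof -
  have nn: "0 \<le> Re (ip u u)" for u
    using pos[of u] by (cases "u = 0") (auto simp: ip_zero_left)
  have eq: "ip_norm ip u = sqrt (Re (ip u u))" for u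
    using nn[of u] by (simp add: ip_norm_def cmod_ip_self)
  have "Re (ip x y) \<le> sqrt (Re (ip x x)) * sqrt (Re (ip y y))"
    using Re_ip_power2_le[OF pos, of x y] by (metis real_le_rsqrt real_sqrt_mult)
  then have "Re (ip (x + y) (x + y)) \<le> (sqrt (Re (ip x x)) + sqrt (Re (ip y y)))\<^sup>2"
    using nn by (simp add: ip_add_left ip_add_right Re_ip_commute[of y x] power2_sum)
  then show ?thesis
    unfolding eq using nn by (intro real_le_lsqrt) auto
qed

lemma Metric_space_ip_dist:
  assumes pos: "\<And>x. x \<noteq> 0 \<Longrightarrow> 0 < Re (ip x x)"
  shows "Metric_space UNIV (ip_dist ip)"
proof
  show "0 \<le> ip_dist ip x y" for x y
    by (simp add: ip_dist_def ip_norm_def)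
  show "ip_dist ip x y = ip_dist ip y x" for x y
    using ip_minus_left[of "x - y" "- (x - y)"] ip_minus_right[of "x - y" "x - y"]
    by (simp add: ip_dist_def ip_norm_def)
  show "ip_dist ip x y = 0 \<longleftrightarrow> x = y" for x y
    using pos[of "x - y"] by (cases "x = y") (auto simp: ip_dist_def ip_norm_def ip_zero_left)
  show "ip_dist ip x z \<le> ip_dist ip x y + ip_dist ip y z" for x y z
    using ip_norm_triangle[OF pos, of "x - y" "y - z"] by (simp add: ip_dist_def)
qed

text \<open>Turns combinations of vectors into combinations over indices. As \<open>f\<close> need
  not be injective on \<open>N\<close>, one index is chosen for each vector involved, and the sum is
  reindexed along \<open>f\<close> on these.\<close>

lemma in_span_imageE:
  assumes "x \<in> span (f ` N)"
  obtains T c where "finite T" "T \<subseteq> N" "x = (\<Sum>n\<in>T. scale (c n) (f n))"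
proof -
  obtain S r where S: "finite S" "S \<subseteq> f ` N" "x = (\<Sum>a\<in>S. scale (r a) a)"
    using assms by (auto simp: span_explicit)
  obtain T where T: "T \<subseteq> N" "finite T" "inj_on f T" "S = f ` T"
    using S(1,2) by (metis subset_image_inj finite_image_iff)
  have "x = (\<Sum>n\<in>T. scale (r (f n)) (f n))"
    using S(3) T(3,4) by (simp add: sum.reindex)
  with T show thesis by (intro that[of T "\<lambda>n. r (f n)"])
qed

section \<open>Finite combinations of a J-orthogonal sequence\<close>

context
  fixes f :: "nat \<Rightarrow> 'a"
  assumes orth: "J_orthogonal f"
begin

lemma ip_combination_right:
  assumes "finite T"
  shows "ip (\<Sum>n\<in>T. scale (c n) (f n)) (f m) = (if m \<in> T then c m * ip (f m) (f m) else 0)"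
proof -
  have "ip (\<Sum>n\<in>T. scale (c n) (f n)) (f m)
      = (\<Sum>n\<in>T. if n = m then c n * ip (f n) (f n) else 0)"
    using orth by (auto simp: ip_sum_left ip_scale_left J_orthogonal_def intro!: sum.cong)
  then show ?thesis
    using assms by simp
qed

lemma Re_ip_combination_self:
  fixes c :: "nat \<Rightarrow> complex"
  assumes "finite T" and x: "x = (\<Sum>n\<in>T. scale (c n) (f n))"
  shows "Re (ip x x) = (\<Sum>n\<in>T. (cmod (c n))\<^sup>2 * Re (ip (f n) (f n)))"
proof -
  \<comment> \<open>Only the left argument is expanded; \<open>x\<close> stays folded on the right,
    so that each \<open>ip (f n) x\<close> is the conjugate of a value given by
    \<open>ip_combination_right\<close>.\<close>
  have "ip x x = (\<Sum>n\<in>T. c n * cnj (ip x (f n)))"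
    using ip_sum_left[of "\<lambda>n. scale (c n) (f n)" T x]
    by (simp add: ip_scale_left ip_hermitian[of "f _" x] flip: x)
  also have "\<dots> = (\<Sum>n\<in>T. c n * cnj (c n) * ip (f n) (f n))"
    using assms(1)
    by (intro sum.cong refl) (simp add: x ip_combination_right flip: ip_hermitian)
  finally show ?thesis
    by (simp add: complex_mult_cnj cmod_power2)
qed

text \<open>A common sign rules out cancellation, so the modulus passes inside the sum.\<close>

lemma cmod_ip_combination_self:
  assumes "finite T" and x: "x = (\<Sum>n\<in>T. scale (c n) (f n))"
    and sgn: "(\<forall>n\<in>T. 0 \<le> Re (ip (f n) (f n))) \<or> (\<forall>n\<in>T. Re (ip (f n) (f n)) \<le> 0)"
  shows "cmod (ip x x) = (\<Sum>n\<in>T. (cmod (c n))\<^sup>2 * cmod (ip (f n) (f n)))"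
  using sgn
proof
  assume pos: "\<forall>n\<in>T. 0 \<le> Re (ip (f n) (f n))"
  then show ?thesis
    using Re_ip_combination_self[OF assms(1,2)]
    by (simp add: cmod_ip_self sum_nonneg)
next
  assume neg: "\<forall>n\<in>T. Re (ip (f n) (f n)) \<le> 0"
  then have "(\<Sum>n\<in>T. (cmod (c n))\<^sup>2 * Re (ip (f n) (f n))) \<le> 0"
    by (intro sum_nonpos) (simp add: mult_nonneg_nonpos)
  then show ?thesis
    using neg Re_ip_combination_self[OF assms(1,2)]
    by (simp add: cmod_ip_self flip: sum_negf)
qed

text \<open>The terms with index outside \<open>T\<close> vanish by orthogonality, so the frame sum
  is finite. The form \<open>has_sum\<close> delivers summability and value together.\<close>

lemma frame_sum_combination:
  assumes "finite T" "T \<subseteq> N" and x: "x = (\<Sum>n\<in>T. scale (c n) (f n))"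
  shows "((\<lambda>n. (cmod (ip x (f n)))\<^sup>2) has_sum
    (\<Sum>n\<in>T. (cmod (c n))\<^sup>2 * (cmod (ip (f n) (f n)))\<^sup>2)) N"
proof -
  have "((\<lambda>n. (cmod (c n))\<^sup>2 * (cmod (ip (f n) (f n)))\<^sup>2) has_sum
    (\<Sum>n\<in>T. (cmod (c n))\<^sup>2 * (cmod (ip (f n) (f n)))\<^sup>2)) T"
    using assms(1) by (rule has_sum_finite)
  then show ?thesis
    using assms(1,2)
    by (subst has_sum_cong_neutral[where T = T and g = "\<lambda>n. (cmod (c n))\<^sup>2 * (cmod (ip (f n) (f n)))\<^sup>2"])
      (auto simp: x ip_combination_right norm_mult power_mult_distrib)
qed

end

end

section \<open>The Hilbert inner product and the topology of the Krein space\<close>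

context krein_space
begin

lemma fundamental_symmetryE:
  obtains Hp Hm where "subspace Hp" "subspace Hm"
    "\<And>x. x \<in> Hp \<Longrightarrow> x \<noteq> 0 \<Longrightarrow> 0 < Re (ip x x)"
    "\<And>x. x \<in> Hm \<Longrightarrow> x \<noteq> 0 \<Longrightarrow> Re (ip x x) < 0"
    "\<And>x y. x \<in> Hp \<Longrightarrow> y \<in> Hm \<Longrightarrow> ip x y = 0"
    "\<And>x. \<exists>y\<in>Hp. \<exists>z\<in>Hm. x = y + z"
    "\<And>x y. x \<in> Hp \<Longrightarrow> y \<in> Hm \<Longrightarrow> J (x + y) = x - y"
proof -
  obtain Hp Hm where H: "fundamental_decomposition Hp Hm"
    "\<forall>x\<in>Hp. \<forall>y\<in>Hm. J (x + y) = x - y"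
    using fundamental_symmetry unfolding fundamental_symmetry_def by blast
  have Hp: "hilbert_space_on Hp ip" and Hm: "hilbert_space_on Hm (\<lambda>x y. - ip x y)"
    and orth: "\<forall>x\<in>Hp. \<forall>y\<in>Hm. ip x y = 0"
    and dec: "\<forall>h. \<exists>x\<in>Hp. \<exists>y\<in>Hm. h = x + y"
    using H(1) unfolding fundamental_decomposition_def by blast+
  have pos: "\<forall>x\<in>Hp. x \<noteq> 0 \<longrightarrow> 0 < Re (ip x x)"
    using Hp unfolding hilbert_space_on_def by blast
  have "\<forall>x\<in>Hm. x \<noteq> 0 \<longrightarrow> 0 < Re (- ip x x)"
    using Hm unfolding hilbert_space_on_def by blast
  then have neg: "\<forall>x\<in>Hm. x \<noteq> 0 \<longrightarrow> Re (ip x x) < 0"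
    by simp
  have "subspace Hp" "subspace Hm"
    using Hp Hm unfolding hilbert_space_on_def by blast+
  from this pos[rule_format] neg[rule_format] orth[rule_format] dec[rule_format] H(2)[rule_format]
  show thesis
    by (rule that)
qed

text \<open>\<open>J\<close> is known only on sums of components from \<open>Hp\<close> and
  \<open>Hm\<close>, so its linearity follows by regrouping components. Hermitian symmetry holds
  because the cross terms vanish, leaving \<open>ip yp xp - ip ym xm\<close>.\<close>

lemma hilbert_ip_space: "indefinite_inner_product_space scale hilbert_ip"
proof -
  obtain Hp Hm where sub: "subspace Hp" "subspace Hm"
    and orth: "\<And>x y. x \<in> Hp \<Longrightarrow> y \<in> Hm \<Longrightarrow> ip x y = 0"
    and dec: "\<And>x. \<exists>y\<in>Hp. \<exists>z\<in>Hm. x = y + z"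
    and J: "\<And>x y. x \<in> Hp \<Longrightarrow> y \<in> Hm \<Longrightarrow> J (x + y) = x - y"
    by (rule fundamental_symmetryE) blast
  show ?thesis
  proof
    fix x y z c
    obtain xp xm where x: "xp \<in> Hp" "xm \<in> Hm" "x = xp + xm" using dec by blast
    obtain yp ym where y: "yp \<in> Hp" "ym \<in> Hm" "y = yp + ym" using dec by blast
    have Jx: "J x = xp - xm" and Jy: "J y = yp - ym" using x y J by auto
    have "J ((xp + yp) + (xm + ym)) = (xp + yp) - (xm + ym)"
      using x y sub by (intro J) (auto simp: subspace_add)
    moreover have "(xp + yp) + (xm + ym) = x + y"
      using x(3) y(3) by (simp add: ac_simps)
    ultimately have "J (x + y) = J x + J y"
      by (simp add: Jx Jy)
    then show "hilbert_ip (x + y) z = hilbert_ip x z + hilbert_ip y z"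
      by (simp add: hilbert_ip_def ip_add_left)
    have "J (scale c xp + scale c xm) = scale c xp - scale c xm"
      using x sub by (intro J) (auto simp: subspace_scale)
    moreover have "scale c xp + scale c xm = scale c x"
      by (simp add: x(3) scale_right_distrib)
    ultimately have "J (scale c x) = scale c (J x)"
      by (simp add: Jx scale_right_diff_distrib)
    then show "hilbert_ip (scale c x) y = c * hilbert_ip x y"
      by (simp add: hilbert_ip_def ip_scale_left)
    have 0: "ip xp ym = 0" "ip yp xm = 0" "ip ym xp = 0" "ip xm yp = 0"
      using orth x y by (auto simp: ip_hermitian[of ym xp] ip_hermitian[of xm yp])
    show "hilbert_ip y x = cnj (hilbert_ip x y)"
      unfolding hilbert_ip_def Jx Jy unfolding x(3) y(3)
      by (simp add: ip_diff_left ip_add_right 0 ip_hermitian[of xp yp] ip_hermitian[of xm ym])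
  qed
qed

text \<open>The sign change in \<open>J\<close> makes the contributions of both components
  nonnegative, and a nonzero vector has a nonzero component.\<close>

lemma Re_hilbert_ip_pos:
  assumes "x \<noteq> 0"
  shows "0 < Re (hilbert_ip x x)"
proof -
  obtain Hp Hm where pos: "\<And>x. x \<in> Hp \<Longrightarrow> x \<noteq> 0 \<Longrightarrow> 0 < Re (ip x x)"
    and neg: "\<And>x. x \<in> Hm \<Longrightarrow> x \<noteq> 0 \<Longrightarrow> Re (ip x x) < 0"
    and orth: "\<And>x y. x \<in> Hp \<Longrightarrow> y \<in> Hm \<Longrightarrow> ip x y = 0"
    and dec: "\<And>x. \<exists>y\<in>Hp. \<exists>z\<in>Hm. x = y + z"
    and J: "\<And>x y. x \<in> Hp \<Longrightarrow> y \<in> Hm \<Longrightarrow> J (x + y) = x - y"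
    by (rule fundamental_symmetryE) blast
  obtain xp xm where x: "xp \<in> Hp" "xm \<in> Hm" "x = xp + xm" using dec by blast
  have 0: "ip xp xm = 0" "ip xm xp = 0"
    using orth x by (auto simp: ip_hermitian[of xm xp])
  have "Re (hilbert_ip x x) = Re (ip xp xp) - Re (ip xm xm)"
    unfolding hilbert_ip_def x(3) J[OF x(1,2)] by (simp add: ip_diff_left ip_add_right 0)
  moreover have "xp \<noteq> 0 \<or> xm \<noteq> 0"
    using assms x(3) by auto
  ultimately show ?thesis
    using pos[OF x(1)] neg[OF x(2)]
    by (cases "xp = 0"; cases "xm = 0") (auto simp: ip_zero_left)
qed

text \<open>Ensures that every set is contained in its closure, which puts the vectors
  \<open>f n\<close> into the closed spans.\<close>

lemma topspace_krein_topology: "topspace krein_topology = UNIV"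
proof -
  interpret hilbert: indefinite_inner_product_space scale hilbert_ip
    by (rule hilbert_ip_space)
  interpret Metric_space UNIV "ip_dist hilbert_ip"
    by (rule hilbert.Metric_space_ip_dist[OF Re_hilbert_ip_pos])
  show ?thesis
    by (simp add: krein_topology_def)
qed

section \<open>Frame inequalities and bounds on \<open>cmod (ip (f n) (f n))\<close>\<close>

lemma span_subset_M_plus: "span (f ` N_plus f) \<subseteq> M_plus f"
  unfolding M_plus_def by (rule closure_of_subset) (simp add: topspace_krein_topology)

text \<open>\<open>N_plus\<close> admits neutral vectors by definition, so positivity of
  \<open>M_plus\<close> is needed there; on its complement the value is strictly negative
  anyway.\<close>

lemma ip_self_neq_0:
  assumes "maximal_definite f" "f n \<noteq> 0"
  shows "ip (f n) (f n) \<noteq> 0"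
proof (cases "n \<in> N_plus f")
  case True
  then have "f n \<in> M_plus f"
    using span_subset_M_plus span_base by blast
  then show ?thesis
    using assms by (auto simp: maximal_definite_def maximal_positive_def positive_subspace_def)
next
  case False
  then show ?thesis
    by (auto simp: N_plus_def)
qed

lemma frame_bounds_on_member:
  assumes orth: "J_orthogonal f" and "frame_bounds_on f N A B" "n \<in> N" "ip (f n) (f n) \<noteq> 0"
  shows "A \<le> cmod (ip (f n) (f n)) \<and> cmod (ip (f n) (f n)) \<le> B"
proof -
  let ?r = "cmod (ip (f n) (f n))"
  have "((\<lambda>m. (cmod (ip (f n) (f m)))\<^sup>2) has_sum
      (\<Sum>m\<in>{n}. (cmod 1)\<^sup>2 * (cmod (ip (f m) (f m)))\<^sup>2)) N"
    by (rule frame_sum_combination[OF orth, where T = "{n}" and c = "\<lambda>_. 1"])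
      (use \<open>n \<in> N\<close> in simp_all)
  then have "((\<lambda>m. (cmod (ip (f n) (f m)))\<^sup>2) has_sum ?r\<^sup>2) N"
    by simp
  then have sum: "(\<Sum>\<^sub>\<infinity>m\<in>N. (cmod (ip (f n) (f m)))\<^sup>2) = ?r\<^sup>2"
    by (rule infsumI)
  have "f n \<in> span (f ` N)"
    using \<open>n \<in> N\<close> by (intro span_base) auto
  \<comment> \<open>At \<open>x = f n\<close> the frame sum is quadratic in \<open>?r\<close> and
    the bounds are linear; a factor \<open>?r > 0\<close> then cancels.\<close>
  with assms(2) have "A * ?r \<le> ?r\<^sup>2 \<and> ?r\<^sup>2 \<le> B * ?r"
    unfolding frame_bounds_on_def by (auto simp: sum dest: bspec[where x = "f n"])
  then show ?thesis
    using assms(4) by (simp add: power2_eq_square)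
qed

text \<open>Both sides are sums with the nonnegative weights
  \<open>(cmod (c n))\<^sup>2 * ?r n\<close>, with the frame sum carrying one more factor
  \<open>?r n\<close>. The disjunction on signs lets one lemma serve \<open>N_plus\<close> and
  \<open>N_minus\<close>.\<close>

lemma frame_bounds_on_if_bounded:
  assumes orth: "J_orthogonal f"
    and bnd: "\<And>n. n \<in> N \<Longrightarrow> A \<le> cmod (ip (f n) (f n)) \<and> cmod (ip (f n) (f n)) \<le> B"
    and sgn: "(\<forall>n\<in>N. 0 \<le> Re (ip (f n) (f n))) \<or> (\<forall>n\<in>N. Re (ip (f n) (f n)) \<le> 0)"
  shows "frame_bounds_on f N A B"
  unfolding frame_bounds_on_def
proof
  fix x
  assume "x \<in> span (f ` N)"
  then obtain T c where T: "finite T" "T \<subseteq> N" and x: "x = (\<Sum>n\<in>T. scale (c n) (f n))"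
    by (rule in_span_imageE)
  let ?r = "\<lambda>n. cmod (ip (f n) (f n))"
  have sum: "((\<lambda>n. (cmod (ip x (f n)))\<^sup>2) has_sum (\<Sum>n\<in>T. (cmod (c n))\<^sup>2 * (?r n)\<^sup>2)) N"
    by (rule frame_sum_combination[OF orth T x])
  have self: "cmod (ip x x) = (\<Sum>n\<in>T. (cmod (c n))\<^sup>2 * ?r n)"
    by (rule cmod_ip_combination_self[OF orth T(1) x]) (use sgn T(2) in blast)
  have "A * cmod (ip x x) \<le> (\<Sum>n\<in>T. (cmod (c n))\<^sup>2 * (?r n)\<^sup>2)"
    unfolding self sum_distrib_left
  proof (rule sum_mono)
    fix n assume "n \<in> T"
    then have "A * ((cmod (c n))\<^sup>2 * ?r n) \<le> ?r n * ((cmod (c n))\<^sup>2 * ?r n)"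
      using bnd T(2) by (intro mult_right_mono) auto
    then show "A * ((cmod (c n))\<^sup>2 * ?r n) \<le> (cmod (c n))\<^sup>2 * (?r n)\<^sup>2"
      by (simp add: power2_eq_square algebra_simps)
  qed
  moreover have "(\<Sum>n\<in>T. (cmod (c n))\<^sup>2 * (?r n)\<^sup>2) \<le> B * cmod (ip x x)"
    unfolding self sum_distrib_left
  proof (rule sum_mono)
    fix n assume "n \<in> T"
    then have "?r n * ((cmod (c n))\<^sup>2 * ?r n) \<le> B * ((cmod (c n))\<^sup>2 * ?r n)"
      using bnd T(2) by (intro mult_right_mono) auto
    then show "(cmod (c n))\<^sup>2 * (?r n)\<^sup>2 \<le> B * ((cmod (c n))\<^sup>2 * ?r n)"
      by (simp add: power2_eq_square algebra_simps)
  qed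
  ultimately show "(\<lambda>n. (cmod (ip x (f n)))\<^sup>2) summable_on N \<and>
      A * cmod (ip x x) \<le> (\<Sum>\<^sub>\<infinity>n\<in>N. (cmod (ip x (f n)))\<^sup>2) \<and>
      (\<Sum>\<^sub>\<infinity>n\<in>N. (cmod (ip x (f n)))\<^sup>2) \<le> B * cmod (ip x x)"
    using has_sum_imp_summable[OF sum] infsumI[OF sum] by simp
qed

lemma J_frame_iff_J_bounded:
  assumes orth: "J_orthogonal f" and nonzero: "\<And>n. f n \<noteq> 0"
  shows "J_frame f \<longleftrightarrow> J_bounded f \<and> maximal_definite f"
proof
  assume frame: "J_frame f"
  then have max: "maximal_definite f"
    by (simp add: J_frame_def)
  obtain A B where "0 < A" and
    bounds: "frame_bounds_on f (N_plus f) A B" "frame_bounds_on f (N_minus f) A B"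
    using frame by (auto simp: J_frame_def)
  have "A \<le> cmod (ip (f n) (f n)) \<and> cmod (ip (f n) (f n)) \<le> B" for n
  proof -
    have "n \<in> N_plus f \<or> n \<in> N_minus f"
      by (auto simp: N_plus_def N_minus_def)
    then show ?thesis
      using bounds frame_bounds_on_member[OF orth] ip_self_neq_0[OF max nonzero] by blast
  qed
  with \<open>0 < A\<close> max show "J_bounded f \<and> maximal_definite f"
    unfolding J_bounded_def by blast
next
  assume *: "J_bounded f \<and> maximal_definite f"
  then obtain A B where "0 < A"
    and bnd: "\<And>n. A \<le> cmod (ip (f n) (f n)) \<and> cmod (ip (f n) (f n)) \<le> B"
    unfolding J_bounded_def by blast
  \<comment> \<open>\<open>J_bounded\<close> does not state this inequality; it follows from the
    bounds at any single index.\<close>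
  have "A \<le> B"
    using bnd[of 0] by linarith
  moreover have "frame_bounds_on f (N_plus f) A B"
    by (rule frame_bounds_on_if_bounded[OF orth bnd]) (auto simp: N_plus_def)
  moreover have "frame_bounds_on f (N_minus f) A B"
    by (rule frame_bounds_on_if_bounded[OF orth bnd]) (auto simp: N_minus_def)
  ultimately show "J_frame f"
    using * \<open>0 < A\<close> unfolding J_frame_def by blast
qed

end

theorem proposition4p2:
  fixes scale :: "complex \<Rightarrow> 'a::ab_group_add \<Rightarrow> 'a"
    and ip :: "'a \<Rightarrow> 'a \<Rightarrow> complex"
    and J :: "'a \<Rightarrow> 'a"
    and f :: "nat \<Rightarrow> 'a"
  assumes krein: "krein_space scale ip J"
    and orthogonal: "indefinite_inner_product_space.J_orthogonal ip f"
    and nonzero: "\<And>n. f n \<noteq> 0"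
  shows "krein_space.J_frame scale ip J f \<longleftrightarrow>
      indefinite_inner_product_space.J_bounded ip f \<and>
      krein_space.maximal_positive scale ip J (krein_space.M_plus scale ip J f) \<and>
      krein_space.maximal_negative scale ip J (krein_space.M_minus scale ip J f)"
proof -
  interpret krein_space scale ip J
    by (rule krein)
  show ?thesis
    using J_frame_iff_J_bounded[OF orthogonal nonzero] unfolding maximal_definite_def .
qed

end
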